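(* Suppose the inequality $\sum_{p\in P} g_p x_p \ge h$, with dual $\gamma \ge 0$, has a resource-robust application, given by non-increasing functions $g_{ij}:\mathbb{R}^m\to\mathbb{R}$, $(i,j)\in A$. Then the inequality can be incorporated into the pricing problem by changing the reduced cost extension function of extending a label $L$ over an arc $(i(L),j)\in A$ to $$\bar c(L\oplus j) = \bar c(L) + c_{i(L),j} - \mu^j - g_{i(L),j}(R(L))\,\gamma ,$$ that is: for every route $p\in P$, the final label obtained by extending the initial label along $p$ with this rule has accumulated reduced cost equal to the reduced cost $\sum_{(i,j)\in p} c_{ij} - \sum_{i\in p}\mu^i - g_p\gamma$ of $p$. Moreover, with this modified extension function, if two labels $L$ and $L'$ satisfy $$\bar c(L)\le \bar c(L'),\qquad i(L)=i(L'),\qquad R(L)\le R(L'),$$ then $L$ dominates $L'$.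
   Context: Let $G=(V,A)$ be a directed graph with $V=\{0,1,\dots,n+1\}$, where $0$ is the starting depot, $n+1$ the ending depot, and $V'=\{1,\dots,n\}$ the customers. Arcs go from $0$ to customers, between customers, and from customers to $n+1$. Arc $(i,j)\in A$ has cost $c_{ij}\in\mathbb{R}$. $P$ is a set of routes (paths, possibly with cycles) from $0$ to $n+1$ in $G$; sums over $i\in p$ or $(i,j)\in p$ repeat vertices or arcs with multiplicity. Let $a_p^i$ be the number of times $p$ visits $i\in V'$. The model is: minimize $\sum_{p\in P}\sum_{(i,j)\in p}c_{ij}x_p$ subject to $\sum_{p\in P}a_p^i x_p=1$ for all $i\in V'$ (duals $\mu^i\in\mathbb{R}$), the valid inequality $\sum_{p\in P}g_px_p\ge h$ (dual $\gamma\ge 0$), and $x_p\in\{0,1\}$ for $p\in P$. Set $\mu^0=\mu^{n+1}=0$. The pricing problem (for the linear relaxation) is $\min_{p\in P}\sum_{(i,j)\in p}c_{ij}-\sum_{i\in p}\mu^i-g_p\gamma$. The pricing problem is modeled as a shortest path problem with resource constraints (SPPRC): each arc $(i,j)\in A$ has a resource extension function (REF) $F_{ij}:\mathbb{R}^m\to\mathbb{R}^m$ and each vertex $i\in V$ has resource bounds $l_i,u_i\in\mathbb{R}^m$. All REFs are assumed non-decreasing: $R\le R'$ implies $F_{ij}(R)\le F_{ij}(R')$. All vector comparisons and maxima are componentwise. A label $L=(\bar c(L),i(L),R(L))$ represents a partial route starting at $0$, with accumulated reduced cost $\bar c(L)\in\mathbb{R}$, current endpoint $i(L)\in V$, and current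 resource vector $R(L)\in\mathbb{R}^m$. The initial label has accumulated reduced cost $0$, endpoint $0$, and a fixed initial resource vector. The extension $L\oplus j$ of $L$ over $(i(L),j)\in A$ has $i(L\oplus j)=j$ and $R(L\oplus j)=\max\{l_j,F_{i(L),j}(R(L))\}$; it is feasible if and only if $l_j\le R(L\oplus j)\le u_j$. Without the valid inequality, the reduced cost extension function is $\bar c(L\oplus j)=\bar c(L)+c_{i(L),j}-\mu^j$. $P$ is the set of routes from $0$ to $n+1$ all of whose extensions are feasible. A completion of a label is a sequence of successive extensions ending at $n+1$; it is feasible if all its extensions are feasible. Label $L$ dominates label $L'$ if every feasible completion of $L'$ is feasible for $L$, and for each of them the resulting accumulated reduced cost starting from $L$ is at most that starting from $L'$. Resource-robust application: $\sum_{p\in P}g_px_p\ge h$ admits a resource-robust application if there exist non-increasing functions $g_{ij}:\mathbb{R}^m\to\mathbb{R}$, $(i,j)\in A$ (i.e. $R\le R'$ implies $g_{ij}(R)\ge g_{ij}(R')$), such that $g_p=\sum_{k=1}^K g_{i_ki_{k+1}}(R_k)$ for every $p=(i_1,\dots,i_{K+1})\in P$ with resource vectors $(R_1,\dots,R_{K+1})$ along the route as defined by the SPPRC ($R_k$ is the resource vector of the label at the $k$th vertex $i_k$). *)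

theory Defs
  imports "HOL-Analysis.Analysis"
begin

text \<open>
  On \<open>real ^ 'm\<close> the order is the componentwise one and \<open>sup\<close> is the componentwise maximum.
\<close>

record ('m :: finite) vrp =
  n_customers :: nat
  arcs :: "(nat \<times> nat) set"
  arc_cost :: "nat \<Rightarrow> nat \<Rightarrow> real"
  ref :: "nat \<Rightarrow> nat \<Rightarrow> real ^ 'm \<Rightarrow> real ^ 'm"
  lower :: "nat \<Rightarrow> real ^ 'm"
  upper :: "nat \<Rightarrow> real ^ 'm"
  init_resources :: "real ^ 'm"

abbreviation end_depot :: "'m :: finite vrp \<Rightarrow> nat" where
  "end_depot I \<equiv> n_customers I + 1"

abbreviation customers :: "'m :: finite vrp \<Rightarrow> nat set" where
  "customers I \<equiv> {1..n_customers I}"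

definition vrp_instance :: "'m :: finite vrp \<Rightarrow> bool" where
  "vrp_instance I \<longleftrightarrow>
     arcs I \<subseteq> ({0} \<times> customers I) \<union> (customers I \<times> customers I) \<union> (customers I \<times> {end_depot I}) \<and>
     (\<forall>(i, j) \<in> arcs I. mono (ref I i j))"

definition extend_resources :: "'m :: finite vrp \<Rightarrow> nat \<Rightarrow> nat \<Rightarrow> real ^ 'm \<Rightarrow> real ^ 'm" where
  "extend_resources I i j R = sup (lower I j) (ref I i j R)"

text \<open>
  \<open>resource_at I R p k\<close> is the resource vector at the \<open>k\<close>th vertex of the vertex sequence \<open>p\<close>
  (counted from 0) when the resource vector at its first vertex is \<open>R\<close>.
\<close>

primrec resource_at :: "'m :: finite vrp \<Rightarrow> real ^ 'm \<Rightarrow> nat list \<Rightarrow> nat \<Rightarrow> real ^ 'm" where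
  "resource_at I R p 0 = R"
| "resource_at I R p (Suc k) = extend_resources I (p ! k) (p ! Suc k) (resource_at I R p k)"

definition path_to_end :: "'m :: finite vrp \<Rightarrow> nat list \<Rightarrow> bool" where
  "path_to_end I p \<longleftrightarrow>
     p \<noteq> [] \<and> successively (\<lambda>i j. (i, j) \<in> arcs I) p \<and> last p = end_depot I"

text \<open>The bounds are imposed on extensions only, hence not at the first vertex of \<open>p\<close>.\<close>

definition feasible_extensions :: "'m :: finite vrp \<Rightarrow> real ^ 'm \<Rightarrow> nat list \<Rightarrow> bool" where
  "feasible_extensions I R p \<longleftrightarrow>
     (\<forall>k. Suc k < length p \<longrightarrow>
        lower I (p ! Suc k) \<le> resource_at I R p (Suc k) \<and>
        resource_at I R p (Suc k) \<le> upper I (p ! Suc k))"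

definition routes :: "'m :: finite vrp \<Rightarrow> nat list set" where
  "routes I = {p. path_to_end I p \<and> hd p = 0 \<and> feasible_extensions I (init_resources I) p}"

definition route_reduced_cost ::
    "'m :: finite vrp \<Rightarrow> (nat \<Rightarrow> real) \<Rightarrow> real \<Rightarrow> (nat list \<Rightarrow> real) \<Rightarrow> nat list \<Rightarrow> real" where
  "route_reduced_cost I \<mu> \<gamma> gp p =
     (\<Sum>(i, j)\<leftarrow>zip p (tl p). arc_cost I i j) - (\<Sum>i\<leftarrow>p. \<mu> i) - gp p * \<gamma>"

text \<open>
  The coefficients \<open>gp\<close> of an inequality over the routes admit a resource-robust application
  if this predicate holds for some \<open>g\<close>.
\<close>

definition resource_robust_application ::
    "'m :: finite vrp \<Rightarrow> (nat list \<Rightarrow> real) \<Rightarrow> (nat \<Rightarrow> nat \<Rightarrow> real ^ 'm \<Rightarrow> real) \<Rightarrow> bool" where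
  "resource_robust_application I gp g \<longleftrightarrow>
     (\<forall>(i, j) \<in> arcs I. antimono (g i j)) \<and>
     (\<forall>p \<in> routes I. gp p =
        (\<Sum>k < length p - 1. g (p ! k) (p ! Suc k) (resource_at I (init_resources I) p k)))"

record ('m :: finite) label =
  red_cost :: real
  endpoint :: nat
  resources :: "real ^ 'm"

definition initial_label :: "'m :: finite vrp \<Rightarrow> 'm label" where
  "initial_label I = \<lparr>red_cost = 0, endpoint = 0, resources = init_resources I\<rparr>"

text \<open>
  A reduced cost extension function \<open>rc\<close> maps a label and the next vertex to the accumulated
  reduced cost of the extended label.
\<close>

definition extend :: "'m :: finite vrp \<Rightarrow> ('m label \<Rightarrow> nat \<Rightarrow> real) \<Rightarrow> 'm label \<Rightarrow> nat \<Rightarrow> 'm label" where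
  "extend I rc L j =
     \<lparr>red_cost = rc L j, endpoint = j,
      resources = extend_resources I (endpoint L) j (resources L)\<rparr>"

definition extend_along ::
    "'m :: finite vrp \<Rightarrow> ('m label \<Rightarrow> nat \<Rightarrow> real) \<Rightarrow> 'm label \<Rightarrow> nat list \<Rightarrow> 'm label" where
  "extend_along I rc L js = foldl (extend I rc) L js"

definition modified_rc ::
    "'m :: finite vrp \<Rightarrow> (nat \<Rightarrow> real) \<Rightarrow> real \<Rightarrow> (nat \<Rightarrow> nat \<Rightarrow> real ^ 'm \<Rightarrow> real) \<Rightarrow> 'm label \<Rightarrow> nat \<Rightarrow> real"
  where
  "modified_rc I \<mu> \<gamma> g L j =
     red_cost L + arc_cost I (endpoint L) j - \<mu> j - g (endpoint L) j (resources L) * \<gamma>"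

text \<open>
  A completion is the list of the vertices extended to; it is empty exactly for labels that
  already end at the ending depot.
\<close>

definition feasible_completion :: "'m :: finite vrp \<Rightarrow> 'm label \<Rightarrow> nat list \<Rightarrow> bool" where
  "feasible_completion I L js \<longleftrightarrow>
     path_to_end I (endpoint L # js) \<and> feasible_extensions I (resources L) (endpoint L # js)"

definition dominates ::
    "'m :: finite vrp \<Rightarrow> ('m label \<Rightarrow> nat \<Rightarrow> real) \<Rightarrow> 'm label \<Rightarrow> 'm label \<Rightarrow> bool" where
  "dominates I rc L L' \<longleftrightarrow>
     (\<forall>js. feasible_completion I L' js \<longrightarrow>
        feasible_completion I L js \<and>
        red_cost (extend_along I rc L js) \<le> red_cost (extend_along I rc L' js))"

end

theory Submission
  imports Defs
begin

text \<open>Unrolling the modified rule gives a closed form for the cost of any extended label: the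
  starting cost plus arc costs, minus duals, minus \<gamma> times the sum of the \<open>g\<close>
  terms along the path (\<open>red_cost_extend_along_modified_rc\<close>). From the initial label,
  that last sum is \<open>gp p\<close>, which yields the first claim. For dominance, smaller
  starting resources stay smaller at every vertex (\<open>resource_at_mono\<close>). Hence
  feasibility is inherited, and each non-increasing \<open>g\<close> term is at least as large;
  since \<gamma> \<ge> 0, at least as much is subtracted, so the cost advantage persists.\<close>

lemma resource_at_Cons_Cons:
  "resource_at I R (i # j # js) (Suc k) = resource_at I (extend_resources I i j R) (j # js) k"
  by (induction k) auto

text \<open>An extension is a non-decreasing REF followed by a maximum with a fixed vector, so it
  preserves the order. The path condition supplies monotonicity, which is assumed of REFs on arcs
  only.\<close>

lemma resource_at_mono:
  assumes "vrp_instance I" "successively (\<lambda>i j. (i, j) \<in> arcs I) p"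
    and "R \<le> R'" "k < length p"
  shows "resource_at I R p k \<le> resource_at I R' p k"
  using \<open>k < length p\<close>
proof (induction k)
  case 0
  show ?case using \<open>R \<le> R'\<close> by simp
next
  case (Suc k)
  have "(p ! k, p ! Suc k) \<in> arcs I"
    using assms(2) Suc.prems by (auto simp: successively_conv_nth)
  then have "mono (ref I (p ! k) (p ! Suc k))"
    using assms(1) by (auto simp: vrp_instance_def)
  then show ?case
    unfolding resource_at.simps extend_resources_def
    using Suc by (intro sup_mono order_refl) (simp add: monoD)
qed

text \<open>Lower bounds hold automatically because of the maximum in each extension; upper bounds
  pass down to smaller resources.\<close>

lemma feasible_extensions_antimono:
  assumes "vrp_instance I" "successively (\<lambda>i j. (i, j) \<in> arcs I) p"
    and "R \<le> R'" "feasible_extensions I R' p"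
  shows "feasible_extensions I R p"
  unfolding feasible_extensions_def
proof (intro allI impI conjI)
  fix k assume k: "Suc k < length p"
  show "lower I (p ! Suc k) \<le> resource_at I R p (Suc k)"
    by (simp add: extend_resources_def)
  have "resource_at I R p (Suc k) \<le> resource_at I R' p (Suc k)"
    using resource_at_mono[OF assms(1-3) k] .
  also have "\<dots> \<le> upper I (p ! Suc k)"
    using assms(4) k unfolding feasible_extensions_def by blast
  finally show "resource_at I R p (Suc k) \<le> upper I (p ! Suc k)" .
qed

text \<open>Stated for an arbitrary label, since the induction changes the starting label and
  dominance compares two of them.\<close>

lemma red_cost_extend_along_modified_rc:
  "red_cost (extend_along I (modified_rc I \<mu> \<gamma> g) L js) =
     red_cost L + (\<Sum>(i, j)\<leftarrow>zip (endpoint L # js) js. arc_cost I i j) - (\<Sum>i\<leftarrow>js. \<mu> i)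
     - (\<Sum>k < length js. g ((endpoint L # js) ! k) (js ! k)
          (resource_at I (resources L) (endpoint L # js) k)) * \<gamma>"
proof (induction js arbitrary: L)
  case Nil
  show ?case by (simp add: extend_along_def)
next
  case (Cons j js)
  define L1 where "L1 = extend I (modified_rc I \<mu> \<gamma> g) L j"
  have "extend_along I (modified_rc I \<mu> \<gamma> g) L (j # js) =
        extend_along I (modified_rc I \<mu> \<gamma> g) L1 js"
    by (simp add: extend_along_def L1_def)
  moreover have "endpoint L1 = j" "red_cost L1 = red_cost L + arc_cost I (endpoint L) j - \<mu> j
       - g (endpoint L) j (resources L) * \<gamma>"
    "resources L1 = extend_resources I (endpoint L) j (resources L)"
    by (simp_all add: L1_def extend_def modified_rc_def)
  \<comment> \<open>The first arc is peeled off: the \<open>k = 0\<close> summand is split from the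
    sum, and the remaining resource vectors are re-rooted at \<open>j\<close>. The deleted simp
    rules would unfold from the far end instead.\<close>
  ultimately show ?case
    using Cons.IH[of L1]
    by (simp add: sum.lessThan_Suc_shift resource_at_Cons_Cons algebra_simps
        del: resource_at.simps(2) sum.lessThan_Suc)
qed

lemma red_cost_route:
  assumes "\<mu> 0 = 0" "resource_robust_application I gp g" "p \<in> routes I"
  shows "red_cost (extend_along I (modified_rc I \<mu> \<gamma> g) (initial_label I) (tl p))
           = route_reduced_cost I \<mu> \<gamma> gp p"
proof -
  obtain js where p: "p = 0 # js"
    using assms(3) by (cases p) (auto simp: routes_def path_to_end_def)
  have "gp p = (\<Sum>k < length js. g (p ! k) (js ! k) (resource_at I (init_resources I) p k))"
    using assms(2,3) by (simp add: resource_robust_application_def p)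
  \<comment> \<open>The duals in the closed form run over \<open>js\<close>, those of the route over
    \<open>0 # js\<close>; \<open>\<mu> 0 = 0\<close> closes the gap.\<close>
  then show ?thesis
    using assms(1)
    by (simp add: red_cost_extend_along_modified_rc route_reduced_cost_def initial_label_def p)
qed

lemma dominates_modified_rc:
  assumes "vrp_instance I" "\<gamma> \<ge> 0" "\<And>i j. (i, j) \<in> arcs I \<Longrightarrow> antimono (g i j)"
    and "red_cost L \<le> red_cost L'" "endpoint L = endpoint L'" "resources L \<le> resources L'"
  shows "dominates I (modified_rc I \<mu> \<gamma> g) L L'"
  unfolding dominates_def
proof (intro allI impI conjI)
  fix js assume feas: "feasible_completion I L' js"
  define p where "p = endpoint L' # js"
  have path: "successively (\<lambda>i j. (i, j) \<in> arcs I) p"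
    using feas by (simp add: feasible_completion_def path_to_end_def p_def)
  show "feasible_completion I L js"
    using feas feasible_extensions_antimono[OF assms(1) path assms(6)]
    by (simp add: feasible_completion_def p_def assms(5))
  have "(\<Sum>k < length js. g (p ! k) (js ! k) (resource_at I (resources L') p k))
        \<le> (\<Sum>k < length js. g (p ! k) (js ! k) (resource_at I (resources L) p k))"
  proof (rule sum_mono)
    fix k assume "k \<in> {..<length js}"
    \<comment> \<open>Prepending the endpoint shifts indices by one, so \<open>js ! k\<close> is
      \<open>p ! Suc k\<close>, the head of the \<open>k\<close>th arc.\<close>
    then have k: "Suc k < length p" by (simp add: p_def)
    then have "(p ! k, p ! Suc k) \<in> arcs I"
      using path by (auto simp: successively_conv_nth)
    then have "antimono (g (p ! k) (js ! k))"
      using assms(3) by (simp add: p_def)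
    then show "g (p ! k) (js ! k) (resource_at I (resources L') p k)
        \<le> g (p ! k) (js ! k) (resource_at I (resources L) p k)"
      using resource_at_mono[OF assms(1) path assms(6), of k] k by (simp add: antimonoD)
  qed
  from mult_right_mono[OF this assms(2)]
  show "red_cost (extend_along I (modified_rc I \<mu> \<gamma> g) L js)
      \<le> red_cost (extend_along I (modified_rc I \<mu> \<gamma> g) L' js)"
    using assms(4) by (simp add: red_cost_extend_along_modified_rc assms(5) p_def)
qed

theorem theorem1:
  fixes I :: "'m :: finite vrp"
    and \<mu> :: "nat \<Rightarrow> real" and \<gamma> :: real
    and gp :: "nat list \<Rightarrow> real"
    and g :: "nat \<Rightarrow> nat \<Rightarrow> real ^ 'm \<Rightarrow> real"
  assumes "vrp_instance I"
    and "\<mu> 0 = 0" and "\<mu> (end_depot I) = 0"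
    and "\<gamma> \<ge> 0"
    and "resource_robust_application I gp g"
  shows "(\<forall>p \<in> routes I.
            red_cost (extend_along I (modified_rc I \<mu> \<gamma> g) (initial_label I) (tl p))
              = route_reduced_cost I \<mu> \<gamma> gp p) \<and>
         (\<forall>L L'. red_cost L \<le> red_cost L' \<and> endpoint L = endpoint L' \<and> resources L \<le> resources L'
            \<longrightarrow> dominates I (modified_rc I \<mu> \<gamma> g) L L')"
proof (intro conjI ballI allI impI)
  fix p assume "p \<in> routes I"
  then show "red_cost (extend_along I (modified_rc I \<mu> \<gamma> g) (initial_label I) (tl p))
      = route_reduced_cost I \<mu> \<gamma> gp p"
    using red_cost_route assms(2,5) by blast
next
  fix L L' :: "'m label"
  assume "red_cost L \<le> red_cost L' \<and> endpoint L = endpoint L' \<and> resources L \<le> resources L'"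
  moreover have "antimono (g i j)" if "(i, j) \<in> arcs I" for i j
    using assms(5) that unfolding resource_robust_application_def by auto
  ultimately show "dominates I (modified_rc I \<mu> \<gamma> g) L L'"
    by (intro dominates_modified_rc assms(1,4)) auto
qed

end
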